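(* Let $V_n=\mathbb{C}[[t]]/(t^{n+1})$ and let $M(n)$ be the arithmetic cost of a product in $V_n$. Let $\mathcal{K}$ be the problem of computing $\log(1+\mathfrak{N})$ in $V_n$ from $\mathfrak{N}\in V_n$ with $\mathfrak{N}(0)=0$ (so $\mathfrak{N}^{n+1}=0$). Then $$L(\mathcal{K})=\Theta(M(n)).$$
   Context: $L(\cdot)$ denotes the arithmetic complexity (number of scalar operations in the arithmetic circuit model over $\mathbb{C}$, as a function of $n$) of a computational problem. Here $\log(1+\mathfrak{N})=\sum_{k=1}^{n}\frac{(-1)^{k+1}}{k}\mathfrak{N}^k$ in $V_n$, and $\mathfrak{N}(0)$ denotes the constant term of $\mathfrak{N}$. $M(n)$ is identified with the cost of multiplying polynomials truncated at degree $n$, and the paper takes it to be superadditive, $M(2n)\ge 2M(n)$. *)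

theory Defs
  imports
    "HOL-Library.Landau_Symbols"
    "HOL-Computational_Algebra.Formal_Power_Series"
begin

section \<open>The truncated power series ring\<close>

text \<open>
  The ring \<open>V\<^sub>n = \<complex>[[t]]/(t\<^sup>n\<^sup>+\<^sup>1)\<close> is represented by the canonical representatives of its
  residue classes, the series without terms of degree above \<open>n\<close>. Reduction modulo
  \<open>t\<^sup>n\<^sup>+\<^sup>1\<close> is \<^term>\<open>fps_cutoff (Suc n)\<close>.
\<close>

definition V :: "nat \<Rightarrow> complex fps set" where
  "V n = {f. \<forall>k>n. fps_nth f k = 0}"

definition V_mult :: "nat \<Rightarrow> complex fps \<Rightarrow> complex fps \<Rightarrow> complex fps" where
  "V_mult n f g = fps_cutoff (Suc n) (f * g)"

primrec V_power :: "nat \<Rightarrow> complex fps \<Rightarrow> nat \<Rightarrow> complex fps" where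
  "V_power n f 0 = 1"
| "V_power n f (Suc k) = V_mult n f (V_power n f k)"

text \<open>\<open>V_log1p n f\<close> is \<open>log (1 + f)\<close> in \<open>V\<^sub>n\<close>, meant for \<open>f\<close> with vanishing constant term.\<close>

definition V_log1p :: "nat \<Rightarrow> complex fps \<Rightarrow> complex fps" where
  "V_log1p n f = (\<Sum>k=1..n. fps_const ((-1) ^ (k + 1) / of_nat k) * V_power n f k)"

lemma V_mult_cong:
  assumes "fps_cutoff (Suc n) f = fps_cutoff (Suc n) f'"
    and "fps_cutoff (Suc n) g = fps_cutoff (Suc n) g'"
  shows "V_mult n f g = V_mult n f' g'"
proof -
  have eq: "fps_nth f i = fps_nth f' i" "fps_nth g i = fps_nth g' i" if "i \<le> n" for i
    using assms that unfolding fps_eq_iff fps_cutoff_nth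
    by (metis le_imp_less_Suc)+
  then show ?thesis
    unfolding V_mult_def fps_eq_iff fps_cutoff_nth fps_mult_nth
    by (auto intro!: sum.cong)
qed

lemma fps_cutoff_power: "fps_cutoff (Suc n) (f ^ k) = V_power n f k"
proof (induction k)
  case 0
  show ?case by (simp add: fps_eq_iff)
next
  case (Suc k)
  have "fps_cutoff (Suc n) (V_power n f k) = V_power n f k"
    unfolding Suc.IH[symmetric] by (simp add: fps_eq_iff)
  then have "V_mult n f (f ^ k) = V_mult n f (V_power n f k)"
    by (intro V_mult_cong) (simp_all add: Suc.IH)
  then show ?case by (simp add: V_mult_def)
qed

lemma V_power_nilpotent:
  assumes "fps_nth f 0 = 0"
  shows "V_power n f (Suc n) = 0"
  using startsby_zero_power_prefix[OF assms, of "Suc n"]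
  by (simp add: fps_cutoff_power[symmetric] fps_eq_iff del: power_Suc V_power.simps)

section \<open>Arithmetic circuits over the complex numbers\<close>

text \<open>
  A circuit is a straight-line program. \<open>Val i\<close> refers to the \<open>i\<close>-th entry of the list
  consisting of the inputs followed by the results of the gates executed so far. Reading
  inputs, using complex constants and selecting outputs are free; each of the four
  arithmetic operations has unit cost.
\<close>

datatype operand = Const complex | Val nat

datatype arith_op = Add | Sub | Mul | Div

datatype gate = Gate arith_op operand operand

datatype circuit = Circuit (gates: "gate list") (outputs: "operand list")

text \<open>
  Evaluation is partial: division by zero and dangling references are failures
  (the convention \<open>x / 0 = 0\<close> of HOL would provide a zero test).
\<close>

fun operand_val :: "complex list \<Rightarrow> operand \<Rightarrow> complex option" where
  "operand_val vs (Const c) = Some c"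
| "operand_val vs (Val i) = (if i < length vs then Some (vs ! i) else None)"

fun arith_op_val :: "arith_op \<Rightarrow> complex \<Rightarrow> complex \<Rightarrow> complex option" where
  "arith_op_val Add x y = Some (x + y)"
| "arith_op_val Sub x y = Some (x - y)"
| "arith_op_val Mul x y = Some (x * y)"
| "arith_op_val Div x y = (if y = 0 then None else Some (x / y))"

fun gate_val :: "complex list \<Rightarrow> gate \<Rightarrow> complex option" where
  "gate_val vs (Gate p a b) =
     Option.bind (operand_val vs a) (\<lambda>x. Option.bind (operand_val vs b) (arith_op_val p x))"

fun run_gates :: "complex list \<Rightarrow> gate list \<Rightarrow> complex list option" where
  "run_gates vs [] = Some vs"
| "run_gates vs (g # gs) = Option.bind (gate_val vs g) (\<lambda>z. run_gates (vs @ [z]) gs)"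

definition eval_circuit :: "circuit \<Rightarrow> complex list \<Rightarrow> complex list option" where
  "eval_circuit C xs =
     Option.bind (run_gates xs (gates C)) (\<lambda>vs. those (map (operand_val vs) (outputs C)))"

definition cost :: "circuit \<Rightarrow> nat" where
  "cost C = length (gates C)"

text \<open>
  A computational problem is the set of its pairs of input and output. A circuit for it has
  to succeed, with the right output, on every admissible input.
\<close>

type_synonym problem = "(complex list \<times> complex list) set"

definition computes :: "circuit \<Rightarrow> problem \<Rightarrow> bool" where
  "computes C P \<longleftrightarrow> (\<forall>(xs, ys) \<in> P. eval_circuit C xs = Some ys)"

text \<open>
  The infimum is an attained minimum for every problem that has a circuit at all, in
  particular for the two below, whose outputs are polynomials in the inputs.
\<close>

definition complexity :: "problem \<Rightarrow> nat" where
  "complexity P = Inf {cost C | C. computes C P}"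

section \<open>Multiplication and logarithm as computational problems\<close>

definition coeffs_upto :: "nat \<Rightarrow> complex fps \<Rightarrow> complex list" where
  "coeffs_upto n f = map (fps_nth f) [0..<Suc n]"

definition mult_problem :: "nat \<Rightarrow> problem" where
  "mult_problem n =
     {(coeffs_upto n f @ coeffs_upto n g, coeffs_upto n (V_mult n f g)) | f g. f \<in> V n \<and> g \<in> V n}"

definition log1p_problem :: "nat \<Rightarrow> problem" where
  "log1p_problem n =
     {(coeffs_upto n f, coeffs_upto n (V_log1p n f)) | f. f \<in> V n \<and> fps_nth f 0 = 0}"

definition M :: "nat \<Rightarrow> nat" where
  "M n = complexity (mult_problem n)"

end

theory Submission
  imports Defs
begin

text \<open>
  Write \<open>L n\<close> for the complexity of the logarithm.

  \<^emph>\<open>Upper bound.\<close> From \<open>t (log (1 + f))' = t f' / (1 + f)\<close> the logarithm costs one inverse, one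
  product and \<open>O(n)\<close> operations for differentiation and integration. The inverse comes from
  Newton's iteration \<open>g \<mapsto> g (2 - a g)\<close>, which doubles the number of correct coefficients at the
  cost of two products. Since \<open>2 * M (n div 2) \<le> M n\<close> by superadditivity and monotonicity, the
  costs of the iterations are dominated by a geometric series, and \<open>n + 1 \<le> M n\<close>
  (lemma \<open>Suc_le_M\<close>) absorbs the linear terms: \<open>L n \<le> 9 * M n\<close> (lemma \<open>log1p_circuit_exists\<close>).

  \<^emph>\<open>Lower bound.\<close> If \<open>h\<close> has degree below \<open>b\<close>, then in
  \<open>log (1 + t\<^sup>2\<^sup>b h) = t\<^sup>2\<^sup>b h - t\<^sup>4\<^sup>b h\<^sup>2 / 2 + \<dots>\<close> the first two summands occupy disjoint ranges of
  degrees below \<open>6 b\<close> and the others begin at \<open>6 b\<close> or later, so that \<open>h\<^sup>2\<close> can be read off (lemma \<open>fps_ln_compose_square_nth\<close>). With \<open>6 b \<le> n + 1\<close> one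
  logarithm in \<open>V\<^sub>n\<close> thus yields a full square of polynomials of degree below \<open>b\<close>, and polarization
  yields products. Elements of \<open>V\<^sub>n\<close> split into twelve blocks of length \<open>b \<approx> n / 6\<close>, so a product
  in \<open>V\<^sub>n\<close> consists of a bounded number of block products and \<open>O(n)\<close> additions
  (lemma \<open>M_le_complexity_log1p\<close>). The linear term is absorbed by \<open>n \<le> L n + 1\<close>
  (lemma \<open>le_complexity_log1p\<close>).

  Both linear lower bounds on complexities come from counting: outputs that are pairwise distinct
  as functions of the input, and that are neither inputs nor constants, need one gate each.

  Circuits are composed without any bookkeeping of indices by viewing a computation as a growing
  set of functions of a common parameter; the translation to and from circuits is done once, in
  lemmas \<open>straight_line_of_circuit\<close> and \<open>circuit_of_straight_line\<close>.
\<close>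

section \<open>Straight-line computation of families of functions\<close>

text \<open>
  A computation is seen through the values that it makes available, as functions of a parameter
  \<open>p\<close> on which the inputs depend; \<open>extends S k T\<close> describes a run of exactly \<open>k\<close> operations. All
  identities are required for every \<open>p\<close>; restrictions on the inputs are built into the way in which
  these depend on the parameter.
\<close>

inductive extends :: "('p \<Rightarrow> complex) set \<Rightarrow> nat \<Rightarrow> ('p \<Rightarrow> complex) set \<Rightarrow> bool"
  for S where
  base: "extends S 0 (S \<union> range (\<lambda>c _. c))"
| step: "extends S k T \<Longrightarrow> a \<in> T \<Longrightarrow> b \<in> T \<Longrightarrow>
    (\<And>p. arith_op_val q (a p) (b p) = Some (h p)) \<Longrightarrow> extends S (Suc k) (insert h T)"

text \<open>
  Passing to a subset of the available values and to a larger number of operations makes this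
  relation monotone in all arguments, so that computations can be estimated and combined freely.
\<close>

definition straight_line ::
    "('p \<Rightarrow> complex) set \<Rightarrow> nat \<Rightarrow> ('p \<Rightarrow> complex) set \<Rightarrow> bool" where
  "straight_line S k T \<longleftrightarrow> (\<exists>l U. l \<le> k \<and> T \<subseteq> U \<and> extends S l U)"

lemma extends_superset: "extends S k T \<Longrightarrow> S \<union> range (\<lambda>c _. c) \<subseteq> T"
  by (induction rule: extends.induct) auto

text \<open>
  A computation from \<open>A\<close> can be replayed after any computation that has made \<open>A\<close> available.
\<close>

lemma extends_trans:
  assumes "extends A l U" "extends S k T" "A \<subseteq> T"
  shows "\<exists>W. extends S (k + l) W \<and> T \<union> U \<subseteq> W"
  using assms(1)
proof (induction rule: extends.induct)
  case base
  show ?case using assms(2,3) extends_superset[OF assms(2)] by (intro exI[of _ T]) auto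
next
  case (step l U a b q h)
  then obtain W where W: "extends S (k + l) W" "T \<union> U \<subseteq> W" by auto
  then have "extends S (Suc (k + l)) (insert h W)"
    using step.hyps by (intro extends.step[where q = q and a = a and b = b]) auto
  with W show ?case by (intro exI[of _ "insert h W"]) auto
qed

lemma straight_line_trivial: "T \<subseteq> S \<union> range (\<lambda>c _. c) \<Longrightarrow> straight_line S k T"
  unfolding straight_line_def by (intro exI[of _ 0]) (auto intro: extends.base)

lemma straight_line_mono:
  assumes "straight_line S k T" "k \<le> l" "U \<subseteq> T"
  shows "straight_line S l U"
  using assms unfolding straight_line_def by (meson order_trans)

lemma straight_line_trans:
  assumes "straight_line S k T" "straight_line (S \<union> T) l U"
  shows "straight_line S (k + l) (T \<union> U)"
proof -
  obtain k' T' where T': "k' \<le> k" "T \<subseteq> T'" "extends S k' T'"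
    using assms(1) unfolding straight_line_def by blast
  obtain l' U' where U': "l' \<le> l" "U \<subseteq> U'" "extends (S \<union> T) l' U'"
    using assms(2) unfolding straight_line_def by blast
  have "S \<union> T \<subseteq> T'" using T' extends_superset[OF T'(3)] by auto
  from extends_trans[OF U'(3) T'(3) this] obtain W where
    "extends S (k' + l') W" "T' \<union> U' \<subseteq> W" by auto
  then show ?thesis using T' U' unfolding straight_line_def
    by (intro exI[of _ "k' + l'"] conjI exI[of _ W]) auto
qed

lemma straight_line_then:
  assumes "straight_line S k T" "straight_line (S \<union> T) l U"
  shows "straight_line S (k + l) U"
  using straight_line_mono[OF straight_line_trans[OF assms]] by auto

lemma straight_line_weaken:
  assumes "straight_line S k T" "S \<subseteq> S'"
  shows "straight_line S' k T"
proof -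
  have "straight_line S' 0 S" using assms(2) by (intro straight_line_trivial) auto
  moreover have "straight_line (S' \<union> S) k T"
  proof -
    obtain l U where U: "l \<le> k" "T \<subseteq> U" "extends S l U"
      using assms(1) unfolding straight_line_def by blast
    from extends_trans[OF U(3) extends.base, of "S' \<union> S"] obtain W where
      "extends (S' \<union> S) (0 + l) W" "U \<subseteq> W" by (meson Un_upper2 le_sup_iff le_supI1)
    then show ?thesis using U unfolding straight_line_def by auto
  qed
  ultimately show ?thesis using straight_line_then by fastforce
qed

lemma straight_line_Un:
  assumes "straight_line S k T" "straight_line S l U"
  shows "straight_line S (k + l) (T \<union> U)"
  using straight_line_trans[OF assms(1) straight_line_weaken[OF assms(2)]] by auto

lemma straight_line_op:
  assumes "a \<in> S \<union> range (\<lambda>c _. c)" "b \<in> S \<union> range (\<lambda>c _. c)"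
    and "\<And>p. arith_op_val q (a p) (b p) = Some (h p)"
  shows "straight_line S 1 {h}"
  unfolding straight_line_def
  using extends.step[OF extends.base assms] by (intro exI[of _ 1]) auto

lemma straight_line_family:
  assumes "finite I" "\<And>i. i \<in> I \<Longrightarrow> straight_line S k {h i}"
  shows "straight_line S (card I * k) (h ` I)"
  using assms
proof (induction rule: finite_induct)
  case empty
  show ?case by (simp add: straight_line_trivial)
next
  case (insert i I)
  have "straight_line S (k + card I * k) ({h i} \<union> h ` I)"
    using insert by (intro straight_line_Un) auto
  then show ?case using insert.hyps by simp
qed

text \<open>
  Each operation provides at most one new value. This is the source of all lower bounds on
  numbers of operations that are linear in \<open>n\<close>.
\<close>

lemma extends_card:
  assumes "extends S k T"
  shows "finite (T - (S \<union> range (\<lambda>c _. c))) \<and> card (T - (S \<union> range (\<lambda>c _. c))) \<le> k"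
  using assms
proof (induction rule: extends.induct)
  case base
  show ?case by simp
next
  case (step k T a b q h)
  let ?B = "S \<union> range (\<lambda>c _. c)"
  have "insert h T - ?B \<subseteq> insert h (T - ?B)" by auto
  moreover have "card (insert h (T - ?B)) \<le> Suc k" "finite (insert h (T - ?B))"
    using step.IH by (auto simp: card_insert_if)
  ultimately show ?case by (meson card_mono finite_subset order_trans)
qed

lemma straight_line_card_le:
  assumes "straight_line S k T" "T \<inter> (S \<union> range (\<lambda>c _. c)) = {}"
  shows "card T \<le> k"
proof -
  obtain l U where U: "l \<le> k" "T \<subseteq> U" "extends S l U"
    using assms(1) unfolding straight_line_def by blast
  have "card T \<le> card (U - (S \<union> range (\<lambda>c _. c)))"
    using U assms(2) extends_card[OF U(3)] by (intro card_mono) auto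
  then show ?thesis using extends_card[OF U(3)] U(1) by auto
qed

section \<open>Circuits and straight-line computation\<close>

lemma those_map_eq_Some_iff:
  "those (map f xs) = Some ys \<longleftrightarrow> list_all2 (\<lambda>x y. f x = Some y) xs ys"
proof (induction xs arbitrary: ys)
  case Nil
  show ?case by auto
next
  case (Cons x xs)
  show ?case
    by (cases ys) (auto simp: Cons.IH[symmetric] split: option.splits)
qed

lemma run_gates_append:
  "run_gates vs (gs @ hs) = Option.bind (run_gates vs gs) (\<lambda>ws. run_gates ws hs)"
  by (induction gs arbitrary: vs) (auto split: bind_splits)

text \<open>
  Whether an operand can be read depends only on the number of available values, not on the
  values. Hence one operand denotes one function of the parameter.
\<close>

lemma operand_val_uniform:
  assumes "set fs \<union> range (\<lambda>c _. c) \<subseteq> T"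
    and "\<And>p. operand_val (map (\<lambda>f. f p) fs) x \<noteq> None"
  obtains a where "a \<in> T" "\<And>p. operand_val (map (\<lambda>f. f p) fs) x = Some (a p)"
proof (cases x)
  case (Const c)
  then show ?thesis using that[of "\<lambda>_. c"] assms(1) by auto
next
  case (Val i)
  with assms(2)[of undefined] have "i < length fs" by (auto split: if_splits)
  then show ?thesis using that[of "fs ! i"] assms(1) Val nth_mem by fastforce
qed

lemma run_gates_extends:
  assumes "extends S k T" "set fs \<subseteq> T"
    and "\<And>p. run_gates (map (\<lambda>f. f p) fs) gs = Some (vs p)"
  shows "\<exists>hs U. extends S (k + length gs) U \<and> set hs \<subseteq> U \<and> (\<forall>p. vs p = map (\<lambda>h. h p) hs)"
  using assms
proof (induction gs arbitrary: k T fs)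
  case Nil
  then show ?case by (intro exI[of _ fs] exI[of _ T]) auto
next
  case (Cons g gs)
  obtain q x y where g: "g = Gate q x y" by (cases g)
  have run: "run_gates (map (\<lambda>f. f p) fs) (g # gs) \<noteq> None" for p
    by (simp add: Cons.prems(3) del: run_gates.simps)
  have super: "set fs \<union> range (\<lambda>c _. c) \<subseteq> T"
    using Cons.prems(2) extends_superset[OF Cons.prems(1)] by auto
  have "operand_val (map (\<lambda>f. f p) fs) x \<noteq> None" for p
    using run[of p] by (cases "operand_val (map (\<lambda>f. f p) fs) x") (simp_all add: g)
  from operand_val_uniform[OF super this] obtain a where
    a: "a \<in> T" "\<And>p. operand_val (map (\<lambda>f. f p) fs) x = Some (a p)" by blast
  have "operand_val (map (\<lambda>f. f p) fs) y \<noteq> None" for p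
    using run[of p] by (cases "operand_val (map (\<lambda>f. f p) fs) y") (simp_all add: g a)
  from operand_val_uniform[OF super this] obtain b where
    b: "b \<in> T" "\<And>p. operand_val (map (\<lambda>f. f p) fs) y = Some (b p)" by blast
  define h where "h p = the (arith_op_val q (a p) (b p))" for p
  have h: "arith_op_val q (a p) (b p) = Some (h p)" for p
    using run[of p] by (cases "arith_op_val q (a p) (b p)") (simp_all add: g a b h_def)
  have "extends S (Suc k) (insert h T)"
    using extends.step[OF Cons.prems(1) a(1) b(1) h] .
  moreover have "set (fs @ [h]) \<subseteq> insert h T" using Cons.prems(2) by auto
  moreover have "run_gates (map (\<lambda>f. f p) (fs @ [h])) gs = Some (vs p)" for p
    using Cons.prems(3)[of p] by (simp add: g a b h)
  ultimately show ?case using Cons.IH[of "Suc k" "insert h T" "fs @ [h]"] by simp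
qed

text \<open>
  A circuit serves as a subroutine: whatever it does internally (divisions included), it succeeds
  on admissible inputs, and each of its gates then computes a function of the parameter.
\<close>

lemma straight_line_of_circuit:
  assumes "computes C P"
    and "\<And>p. (map (\<lambda>f. f p) fs, map (\<lambda>g. g p) gs) \<in> P"
    and "set fs \<subseteq> S \<union> range (\<lambda>c _. c)"
  shows "straight_line S (cost C) (set gs)"
proof -
  have eval: "eval_circuit C (map (\<lambda>f. f p) fs) = Some (map (\<lambda>g. g p) gs)" for p
    using assms(1,2) unfolding computes_def by blast
  define vs where "vs p = the (run_gates (map (\<lambda>f. f p) fs) (gates C))" for p
  have vs: "run_gates (map (\<lambda>f. f p) fs) (gates C) = Some (vs p)" for p
    using eval[of p] by (cases "run_gates (map (\<lambda>f. f p) fs) (gates C)")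
      (auto simp: vs_def eval_circuit_def)
  from run_gates_extends[OF extends.base assms(3) vs] obtain hs U where
    U: "extends S (length (gates C)) U" "set hs \<subseteq> U" "\<And>p. vs p = map (\<lambda>h. h p) hs"
    by auto
  have outs: "list_all2 (\<lambda>x y. operand_val (map (\<lambda>h. h p) hs) x = Some y)
      (outputs C) (map (\<lambda>g. g p) gs)" for p
    using eval[of p] by (simp add: eval_circuit_def vs U(3) those_map_eq_Some_iff)
  have "g \<in> U" if "g \<in> set gs" for g
  proof -
    from that obtain i where i: "i < length gs" "g = gs ! i" by (auto simp: in_set_conv_nth)
    have g: "operand_val (map (\<lambda>h. h p) hs) (outputs C ! i) = Some (g p)" for p
      using list_all2_nthD2[OF outs[of p], of i] i by simp
    have "set hs \<union> range (\<lambda>c _. c) \<subseteq> U" using U(2) extends_superset[OF U(1)] by auto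
    from operand_val_uniform[OF this, of "outputs C ! i"] g obtain a where
      "a \<in> U" "\<And>p. operand_val (map (\<lambda>h. h p) hs) (outputs C ! i) = Some (a p)" by auto
    with g have "a = g" by auto
    with \<open>a \<in> U\<close> show ?thesis by simp
  qed
  then show ?thesis using U(1) unfolding straight_line_def cost_def by blast
qed

lemma operand_of_function:
  assumes "a \<in> set hs \<union> range (\<lambda>c _. c)"
  obtains x where "\<And>p. operand_val (map (\<lambda>h. h p) hs) x = Some (a p)"
proof -
  from assms consider c where "a = (\<lambda>_. c)" | i where "i < length hs" "a = hs ! i"
    by (auto simp: in_set_conv_nth)
  then show ?thesis
  proof cases
    case (1 c)
    then show ?thesis using that[of "Const c"] by simp
  next
    case (2 i)
    then show ?thesis using that[of "Val i"] by simp
  qed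
qed

lemma gates_of_extends:
  assumes "extends (set fs) k T"
  shows "\<exists>gs hs. length gs = k \<and> T \<subseteq> set hs \<union> range (\<lambda>c _. c) \<and>
    (\<forall>p. run_gates (map (\<lambda>f. f p) fs) gs = Some (map (\<lambda>h. h p) hs))"
  using assms
proof (induction rule: extends.induct)
  case base
  show ?case by (intro exI[of _ "[]"] exI[of _ fs]) simp
next
  case (step k T a b q h)
  then obtain gs hs where gs: "length gs = k" "T \<subseteq> set hs \<union> range (\<lambda>c _. c)"
    "\<And>p. run_gates (map (\<lambda>f. f p) fs) gs = Some (map (\<lambda>h. h p) hs)" by auto
  have "a \<in> set hs \<union> range (\<lambda>c _. c)" "b \<in> set hs \<union> range (\<lambda>c _. c)"
    using step.hyps gs(2) by auto
  from this[THEN operand_of_function] obtain x y where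
    "\<And>p. operand_val (map (\<lambda>h. h p) hs) x = Some (a p)"
    "\<And>p. operand_val (map (\<lambda>h. h p) hs) y = Some (b p)" by metis
  then have "run_gates (map (\<lambda>f. f p) fs) (gs @ [Gate q x y])
      = Some (map (\<lambda>h. h p) (hs @ [h]))" for p
    using step.hyps gs(3) by (simp add: run_gates_append)
  then show ?case using gs(1,2)
    by (intro exI[of _ "gs @ [Gate q x y]"] exI[of _ "hs @ [h]"]) auto
qed

text \<open>
  The premise on \<open>P\<close> says that the parametrization reaches all admissible inputs.
\<close>

lemma circuit_of_straight_line:
  assumes "straight_line (set fs) k (set gs)"
    and "\<And>xs ys. (xs, ys) \<in> P \<Longrightarrow> \<exists>p. xs = map (\<lambda>f. f p) fs \<and> ys = map (\<lambda>g. g p) gs"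
  shows "\<exists>C. computes C P \<and> cost C \<le> k"
proof -
  obtain l U where U: "l \<le> k" "set gs \<subseteq> U" "extends (set fs) l U"
    using assms(1) unfolding straight_line_def by blast
  from gates_of_extends[OF U(3)] obtain G hs where
    G: "length G = l" "U \<subseteq> set hs \<union> range (\<lambda>c _. c)"
    "\<And>p. run_gates (map (\<lambda>f. f p) fs) G = Some (map (\<lambda>h. h p) hs)" by auto
  have "\<forall>g\<in>set gs. \<exists>x. \<forall>p. operand_val (map (\<lambda>h. h p) hs) x = Some (g p)"
  proof
    fix g assume "g \<in> set gs"
    with U(2) G(2) have "g \<in> set hs \<union> range (\<lambda>c _. c)" by (meson subsetD)
    then show "\<exists>x. \<forall>p. operand_val (map (\<lambda>h. h p) hs) x = Some (g p)"
      by (rule operand_of_function) (intro exI allI)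
  qed
  from bchoice[OF this] obtain out where
    out: "\<And>g p. g \<in> set gs \<Longrightarrow> operand_val (map (\<lambda>h. h p) hs) (out g) = Some (g p)"
    by blast
  have "eval_circuit (Circuit G (map out gs)) (map (\<lambda>f. f p) fs) = Some (map (\<lambda>g. g p) gs)" for p
  proof -
    have "those (map (operand_val (map (\<lambda>h. h p) hs)) (map out gs)) = Some (map (\<lambda>g. g p) gs)"
      unfolding those_map_eq_Some_iff by (simp add: list_all2_conv_all_nth out)
    then show ?thesis by (simp add: eval_circuit_def G(3))
  qed
  then have "computes (Circuit G (map out gs)) P"
    unfolding computes_def using assms(2) by fastforce
  then show ?thesis using U(1) G(1) by (auto simp: cost_def)
qed

lemma complexity_le: "computes C P \<Longrightarrow> complexity P \<le> cost C"
  unfolding complexity_def by (auto intro: wellorder_Inf_le1)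

text \<open>
  The existence of some circuit matters here, because the infimum of the empty set of natural
  numbers is zero.
\<close>

lemma complexity_attained:
  assumes "computes C P"
  obtains C' where "computes C' P" "cost C' = complexity P"
proof -
  have "complexity P \<in> {cost C | C. computes C P}"
    unfolding complexity_def using assms by (intro Inf_nat_def1) auto
  then show ?thesis using that by auto
qed

section \<open>Computing with coefficients of power series\<close>

text \<open>
  Power series enter computations through their first \<open>n + 1\<close> coefficients as functions of the
  parameter.
\<close>

definition coeff_funs :: "nat \<Rightarrow> ('p \<Rightarrow> complex fps) \<Rightarrow> ('p \<Rightarrow> complex) set" where
  "coeff_funs n F = (\<lambda>i p. fps_nth (F p) i) ` {..n}"

lemma coeff_funs_subset_iff:
  "coeff_funs n F \<subseteq> T \<longleftrightarrow> (\<forall>i\<le>n. (\<lambda>p. fps_nth (F p) i) \<in> T)"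
  unfolding coeff_funs_def by auto

lemma coeff_funs_cong:
  assumes "\<And>p i. i \<le> n \<Longrightarrow> fps_nth (F p) i = fps_nth (G p) i"
  shows "coeff_funs n F = coeff_funs n G"
proof -
  have "(\<lambda>p. fps_nth (F p) i) = (\<lambda>p. fps_nth (G p) i)" if "i \<le> n" for i
    using assms that by auto
  then show ?thesis unfolding coeff_funs_def by (intro image_cong) auto
qed

text \<open>
  Truncation is free, since the vanishing coefficients are constants.
\<close>

lemma coeff_funs_cutoff_subset:
  "coeff_funs n (\<lambda>p. fps_cutoff (Suc m) (F p)) \<subseteq> coeff_funs m F \<union> range (\<lambda>c _. c)"
proof -
  have "(\<lambda>p. fps_nth (fps_cutoff (Suc m) (F p)) i) \<in> coeff_funs m F \<union> range (\<lambda>c _. c)" for i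
    by (cases "i \<le> m") (auto simp: coeff_funs_def)
  then show ?thesis by (simp add: coeff_funs_subset_iff)
qed

definition coeff_list :: "nat \<Rightarrow> ('p \<Rightarrow> complex fps) \<Rightarrow> ('p \<Rightarrow> complex) list" where
  "coeff_list n F = map (\<lambda>i p. fps_nth (F p) i) [0..<Suc n]"

lemma set_coeff_list: "set (coeff_list n F) = coeff_funs n F"
  unfolding coeff_list_def coeff_funs_def 
  by (simp add: lessThan_Suc_atMost atLeast0LessThan del: upt_Suc)

lemma map_coeff_list: "map (\<lambda>f. f p) (coeff_list n F) = coeffs_upto n (F p)"
  unfolding coeff_list_def coeffs_upto_def by (simp del: upt_Suc)

lemma coeffs_upto_cong:
  assumes "\<And>i. i \<le> n \<Longrightarrow> fps_nth f i = fps_nth g i"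
  shows "coeffs_upto n f = coeffs_upto n g"
  using assms unfolding coeffs_upto_def by (auto simp del: upt_Suc)

lemma straight_line_coeffwise:
  assumes "\<And>i. i \<le> n \<Longrightarrow> straight_line S 1 {\<lambda>p. fps_nth (F p) i}"
  shows "straight_line S (n + 1) (coeff_funs n F)"
  using straight_line_family[of "{..n}" S 1 "\<lambda>i p. fps_nth (F p) i"] assms
  unfolding coeff_funs_def by auto

lemma straight_line_add:
  assumes "coeff_funs n F \<subseteq> S \<union> range (\<lambda>c _. c)" "coeff_funs n G \<subseteq> S \<union> range (\<lambda>c _. c)"
  shows "straight_line S (n + 1) (coeff_funs n (\<lambda>p. F p + G p))"
  using assms unfolding coeff_funs_subset_iff
  by (intro straight_line_coeffwise straight_line_op[where q = Add]) auto

lemma straight_line_diff: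
  assumes "coeff_funs n F \<subseteq> S \<union> range (\<lambda>c _. c)" "coeff_funs n G \<subseteq> S \<union> range (\<lambda>c _. c)"
  shows "straight_line S (n + 1) (coeff_funs n (\<lambda>p. F p - G p))"
  using assms unfolding coeff_funs_subset_iff
  by (intro straight_line_coeffwise straight_line_op[where q = Sub]) auto

text \<open>
  The weights \<open>w\<close> may vary with the degree, so that differentiation and integration are instances.
\<close>

lemma straight_line_scale:
  assumes "coeff_funs n F \<subseteq> S \<union> range (\<lambda>c _. c)"
    and "\<And>p i. i \<le> n \<Longrightarrow> fps_nth (G p) i = w i * fps_nth (F p) i"
  shows "straight_line S (n + 1) (coeff_funs n G)"
proof (rule straight_line_coeffwise)
  fix i assume "i \<le> n"
  then show "straight_line S 1 {\<lambda>p. fps_nth (G p) i}"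
    using assms unfolding coeff_funs_subset_iff
    by (intro straight_line_op[where q = Mul and a = "\<lambda>_. w i"]) auto
qed

lemma straight_line_sum:
  assumes "finite I" "\<And>i. i \<in> I \<Longrightarrow> straight_line S k (coeff_funs n (F i))"
  shows "straight_line S (card I * (k + (n + 1))) (coeff_funs n (\<lambda>p. \<Sum>i\<in>I. F i p))"
  using assms
proof (induction rule: finite_induct)
  case empty
  show ?case by (intro straight_line_trivial) (auto simp: coeff_funs_def)
next
  case (insert i I)
  have "straight_line S (k + card I * (k + (n + 1)))
      (coeff_funs n (F i) \<union> coeff_funs n (\<lambda>p. \<Sum>i\<in>I. F i p))"
    using insert by (intro straight_line_Un) auto
  then have "straight_line S (k + card I * (k + (n + 1)) + (n + 1))
      (coeff_funs n (\<lambda>p. F i p + (\<Sum>i\<in>I. F i p)))"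
    by (rule straight_line_then) (intro straight_line_add; auto)
  then show ?case using insert.hyps by (simp add: algebra_simps)
qed

section \<open>Products\<close>

lemma fps_cutoff_mult_nth:
  "i \<le> n \<Longrightarrow> fps_nth (fps_cutoff (Suc n) f * fps_cutoff (Suc n) g) i = fps_nth (f * g) i"
  by (auto simp: fps_mult_nth intro!: sum.cong)

lemma mult_circuit_of_straight_line:
  assumes "straight_line (coeff_funs n fst \<union> coeff_funs n snd) k (coeff_funs n (\<lambda>p. fst p * snd p))"
  shows "\<exists>C. computes C (mult_problem n) \<and> cost C \<le> k"
proof (rule circuit_of_straight_line)
  show "straight_line (set (coeff_list n fst @ coeff_list n snd)) k
      (set (coeff_list n (\<lambda>p. fst p * snd p)))"
    using assms by (simp add: set_coeff_list)
next
  fix xs ys assume "(xs, ys) \<in> mult_problem n"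
  then obtain f g where "xs = coeffs_upto n f @ coeffs_upto n g" "ys = coeffs_upto n (V_mult n f g)"
    unfolding mult_problem_def by blast
  moreover have "coeffs_upto n (V_mult n f g) = coeffs_upto n (f * g)"
    by (intro coeffs_upto_cong) (simp add: V_mult_def)
  ultimately show "\<exists>p. xs = map (\<lambda>f. f p) (coeff_list n fst @ coeff_list n snd) \<and>
      ys = map (\<lambda>g. g p) (coeff_list n (\<lambda>p. fst p * snd p))"
    by (intro exI[of _ "(f, g)"]) (simp add: map_coeff_list)
qed

text \<open>
  The schoolbook method; only the existence of a circuit matters.
\<close>

lemma mult_circuit_exists: "\<exists>C. computes C (mult_problem n)"
proof -
  let ?S = "coeff_funs n fst \<union> coeff_funs n snd :: (complex fps \<times> complex fps \<Rightarrow> complex) set"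
  define Q where "Q i p = fps_const (fps_nth (fst p) i) * fps_X ^ i * snd p"
    for i and p :: "complex fps \<times> complex fps"
  have nth: "fps_nth (Q i p) j = (if i \<le> j then fps_nth (fst p) i * fps_nth (snd p) (j - i) else 0)"
    for i j p by (simp add: Q_def mult.assoc fps_X_power_mult_nth)
  have "straight_line ?S (n + 1) (coeff_funs n (Q i))" if "i \<le> n" for i
  proof (rule straight_line_coeffwise)
    fix j assume j: "j \<le> n"
    show "straight_line ?S 1 {\<lambda>p. fps_nth (Q i p) j}"
    proof (cases "i \<le> j")
      case True
      with j that show ?thesis
        by (intro straight_line_op[where q = Mul and a = "\<lambda>p. fps_nth (fst p) i"
              and b = "\<lambda>p. fps_nth (snd p) (j - i)"]) (auto simp: nth coeff_funs_def)
    next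
      case False
      then show ?thesis by (intro straight_line_trivial) (auto simp: nth)
    qed
  qed
  then have "straight_line ?S (card {..n} * ((n + 1) + (n + 1)))
      (coeff_funs n (\<lambda>p. \<Sum>i\<in>{..n}. Q i p))"
    by (intro straight_line_sum) auto
  moreover have "coeff_funs n (\<lambda>p. \<Sum>i\<in>{..n}. Q i p) = coeff_funs n (\<lambda>p. fst p * snd p)"
  proof (rule coeff_funs_cong)
    fix p and j :: nat assume j: "j \<le> n"
    have "fps_nth (\<Sum>i\<in>{..n}. Q i p) j =
        (\<Sum>i\<le>n. if i \<le> j then fps_nth (fst p) i * fps_nth (snd p) (j - i) else 0)"
      by (simp add: fps_sum_nth nth)
    also have "\<dots> = (\<Sum>i\<in>{0..j}. fps_nth (fst p) i * fps_nth (snd p) (j - i))"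
      using j by (intro sum.mono_neutral_cong_right) auto
    finally show "fps_nth (\<Sum>i\<in>{..n}. Q i p) j = fps_nth (fst p * snd p) j"
      by (simp add: fps_mult_nth)
  qed
  ultimately show ?thesis using mult_circuit_of_straight_line by metis
qed

text \<open>
  The cutoffs of the factors are admissible inputs of the multiplication problem and determine
  the product up to degree \<open>n\<close>.
\<close>

lemma straight_line_mult:
  assumes "coeff_funs n F \<subseteq> S \<union> range (\<lambda>c _. c)" "coeff_funs n G \<subseteq> S \<union> range (\<lambda>c _. c)"
  shows "straight_line S (M n) (coeff_funs n (\<lambda>p. F p * G p))"
proof -
  obtain C' where "computes C' (mult_problem n)"
    using mult_circuit_exists by blast
  then obtain C where C: "computes C (mult_problem n)" "cost C = M n"
    unfolding M_def by (rule complexity_attained)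
  have "(map (\<lambda>f. f p) (coeff_list n F @ coeff_list n G),
      map (\<lambda>g. g p) (coeff_list n (\<lambda>p. F p * G p))) \<in> mult_problem n" for p
  proof -
    let ?f = "fps_cutoff (Suc n) (F p)" and ?g = "fps_cutoff (Suc n) (G p)"
    have "coeffs_upto n (V_mult n ?f ?g) = coeffs_upto n (F p * G p)"
      by (intro coeffs_upto_cong) (simp add: V_mult_def fps_cutoff_mult_nth)
    moreover have "coeffs_upto n ?f = coeffs_upto n (F p)" "coeffs_upto n ?g = coeffs_upto n (G p)"
      by (intro coeffs_upto_cong; simp)+
    moreover have "?f \<in> V n" "?g \<in> V n" by (auto simp: V_def)
    ultimately show ?thesis unfolding mult_problem_def map_append map_coeff_list
      by (intro CollectI exI[of _ ?f] exI[of _ ?g]) simp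
  qed
  from straight_line_of_circuit[OF C(1) this] show ?thesis
    using assms C(2) by (simp add: set_coeff_list)
qed

lemma M_le_of_straight_line:
  assumes "straight_line (coeff_funs n fst \<union> coeff_funs n snd) k
    (coeff_funs n (\<lambda>p. fps_cutoff (Suc n) (fst p) * fps_cutoff (Suc n) (snd p)))"
  shows "M n \<le> k"
proof -
  have "coeff_funs n (\<lambda>p. fps_cutoff (Suc n) (fst p) * fps_cutoff (Suc n) (snd p))
      = coeff_funs n (\<lambda>p. fst p * snd p)"
    by (intro coeff_funs_cong fps_cutoff_mult_nth)
  with assms obtain C where "computes C (mult_problem n)" "cost C \<le> k"
    using mult_circuit_of_straight_line by metis
  then show ?thesis unfolding M_def using complexity_le order_trans by blast
qed

text \<open>
  A product in a larger truncated ring, applied to polynomials of degree at most \<open>m\<close>, has the same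
  coefficients up to degree \<open>m\<close>.
\<close>

lemma M_mono:
  assumes "m \<le> n"
  shows "M m \<le> M n"
proof (rule M_le_of_straight_line)
  let ?S = "coeff_funs m fst \<union> coeff_funs m snd :: (complex fps \<times> complex fps \<Rightarrow> complex) set"
  have "straight_line ?S (M n)
      (coeff_funs n (\<lambda>p. fps_cutoff (Suc m) (fst p) * fps_cutoff (Suc m) (snd p)))"
    using coeff_funs_cutoff_subset[of n m fst] coeff_funs_cutoff_subset[of n m snd]
    by (intro straight_line_mult) auto
  then show "straight_line ?S (M n)
      (coeff_funs m (\<lambda>p. fps_cutoff (Suc m) (fst p) * fps_cutoff (Suc m) (snd p)))"
    by (rule straight_line_mono) (use assms in \<open>auto simp: coeff_funs_def\<close>)
qed

text \<open>
  The \<open>n + 1\<close> coefficients of the product are told apart from each other, from the inputs and from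
  constants by inputs of the form \<open>(t\<^sup>j, 1)\<close>, \<open>(t\<^sup>j, 0)\<close> and \<open>(0, t\<^sup>j)\<close>.
\<close>

lemma Suc_le_M: "n + 1 \<le> M n"
proof -
  let ?S = "coeff_funs n fst \<union> coeff_funs n snd :: (complex fps \<times> complex fps \<Rightarrow> complex) set"
  define h where "h i p = fps_nth (fst p * snd p) i" for i and p :: "complex fps \<times> complex fps"
  have sl: "straight_line ?S (M n) (h ` {..n})"
    using straight_line_mult[of n fst ?S snd]
    by (simp add: coeff_funs_def h_def[abs_def] subset_iff)
  have h_X: "h i (fps_X ^ j, 1) = (if i = j then 1 else 0)" for i j
    by (simp add: h_def fps_X_power_nth)
  have h_0: "h i (a, 0) = 0" "h i (0, a) = 0" for i a
    by (simp_all add: h_def)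
  have "h i \<noteq> (\<lambda>_. c)" for i c
    using h_X[of i i] h_0(1)[of i 0] by auto
  moreover have "h i \<noteq> (\<lambda>p. fps_nth (fst p) j)" for i j
    using h_0(1)[of i "fps_X ^ j"] by (auto dest: fun_cong[where x = "(fps_X ^ j, 0)"])
  moreover have "h i \<noteq> (\<lambda>p. fps_nth (snd p) j)" for i j
    using h_0(2)[of i "fps_X ^ j"] by (auto dest: fun_cong[where x = "(0, fps_X ^ j)"])
  ultimately have "h ` {..n} \<inter> (?S \<union> range (\<lambda>c _. c)) = {}"
    by (auto simp: coeff_funs_def)
  from straight_line_card_le[OF sl this] have "card (h ` {..n}) \<le> M n" .
  moreover have "inj_on h {..n}"
  proof (rule inj_onI)
    fix i j assume "h i = h j"
    from fun_cong[OF this, of "(fps_X ^ i, 1)"] show "i = j"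
      by (simp add: h_X split: if_splits)
  qed
  ultimately show ?thesis by (simp add: card_image)
qed

section \<open>Inverses and logarithms\<close>

text \<open>
  The Newton step is quadratically convergent because its error is
  \<open>inverse a - g (2 - a g) = a (inverse a - g)\<^sup>2\<close>.
\<close>

lemma newton_inverse_nth:
  fixes a :: "complex fps"
  assumes "fps_nth a 0 \<noteq> 0" "i < 2 * m"
  defines "g \<equiv> fps_cutoff m (inverse a)"
  shows "fps_nth (g * (2 - a * g)) i = fps_nth (inverse a) i"
proof -
  define d where "d = fps_shift m (inverse a)"
  have split: "inverse a = g + fps_X ^ m * d"
    by (simp add: fps_eq_iff g_def d_def fps_X_power_mult_nth)
  have "inverse a * a = 1" using assms(1) by (rule inverse_mult_eq_1)
  then have "inverse a - g * (2 - a * g) = a * (inverse a - g)\<^sup>2"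
    by (simp add: power2_eq_square) algebra
  also have "\<dots> = fps_X ^ (2 * m) * (a * d\<^sup>2)"
    by (simp add: split power_mult_distrib mult_ac flip: power_mult)
  finally have "inverse a = g * (2 - a * g) + fps_X ^ (2 * m) * (a * d\<^sup>2)"
    by (simp add: algebra_simps)
  then have "fps_nth (inverse a) i =
      fps_nth (g * (2 - a * g)) i + fps_nth (fps_X ^ (2 * m) * (a * d\<^sup>2)) i"
    by (metis fps_add_nth)
  with assms(2) show ?thesis by (simp only: fps_X_power_mult_nth) simp
qed

text \<open>
  With constant term 1 the inverse modulo \<open>t\<close> is free. Otherwise the inverse up to degree
  \<open>m = n div 2\<close> is correct for \<open>m + 1\<close> coefficients, and one Newton step gives
  \<open>2 (m + 1) > n\<close> correct ones for \<open>2 * M n + (n + 1) \<le> 3 * M n\<close> operations, while the recursive call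
  costs at most \<open>6 * M m \<le> 3 * M n\<close>. Superadditivity says nothing about \<open>m = 0\<close>, hence the separate
  value of the bound at \<open>n = 0\<close>.
\<close>

lemma straight_line_inverse:
  assumes superadditive: "\<And>n. n \<ge> 1 \<Longrightarrow> 2 * M n \<le> M (2 * n)"
    and "\<And>p. fps_nth (F p) 0 = 1"
    and "coeff_funs n F \<subseteq> S \<union> range (\<lambda>c _. c)"
  shows "straight_line S (if n = 0 then 0 else 6 * M n) (coeff_funs n (\<lambda>p. inverse (F p)))"
  using assms(3)
proof (induction n rule: less_induct)
  case (less n)
  show ?case
  proof (cases "n = 0")
    case True
    then show ?thesis
      using assms(2) by (intro straight_line_trivial) (auto simp: coeff_funs_def)
  next
    case False
    define m where "m = n div 2"
    have m: "m < n" "n < 2 * Suc m" using False by (auto simp: m_def)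
    define c where "c = (if m = 0 then 0 else 6 * M m)"
    have "2 * c \<le> 6 * M n"
    proof (cases "m = 0")
      case False
      then have "2 * M m \<le> M (2 * m)" by (intro superadditive) auto
      also have "\<dots> \<le> M n" by (intro M_mono) (simp add: m_def)
      finally show ?thesis using False by (simp add: c_def)
    qed (simp add: c_def)
    then have cost: "c + (M n + ((n + 1) + M n)) \<le> 6 * M n"
      using Suc_le_M[of n] by linarith
    \<comment> \<open>Each letter is one stage of the Newton step \<open>g (2 - a g)\<close>: \<open>G = g\<close>, \<open>E = a g\<close>, \<open>D = 2 - a g\<close>.\<close>
    define G where "G p = fps_cutoff (Suc m) (inverse (F p))" for p
    define E where "E p = F p * G p" for p
    define D where "D p = 2 - E p" for p
    let ?T = "coeff_funs m (\<lambda>p. inverse (F p))"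
    have "coeff_funs m F \<subseteq> S \<union> range (\<lambda>c _. c)"
      using less.prems m by (auto simp: coeff_funs_subset_iff)
    with m have T: "straight_line S c ?T" unfolding c_def by (intro less.IH)
    have G: "coeff_funs n G \<subseteq> ?T \<union> range (\<lambda>c _. c)"
      unfolding G_def by (rule coeff_funs_cutoff_subset)
    have E: "straight_line (S \<union> ?T) (M n) (coeff_funs n E)"
      unfolding E_def using less.prems G by (intro straight_line_mult) auto
    have D: "straight_line (S \<union> ?T \<union> coeff_funs n E) (n + 1) (coeff_funs n D)"
      unfolding D_def by (intro straight_line_diff) (auto simp: coeff_funs_def)
    have "straight_line (S \<union> ?T \<union> coeff_funs n E \<union> coeff_funs n D) (M n)
        (coeff_funs n (\<lambda>p. G p * D p))"
      using G by (intro straight_line_mult) auto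
    from straight_line_then[OF T straight_line_then[OF E straight_line_then[OF D this]]]
    have "straight_line S (6 * M n) (coeff_funs n (\<lambda>p. G p * D p))"
      using cost by (rule straight_line_mono) simp
    moreover have "coeff_funs n (\<lambda>p. G p * D p) = coeff_funs n (\<lambda>p. inverse (F p))"
      using m assms(2) unfolding G_def D_def E_def
      by (intro coeff_funs_cong newton_inverse_nth) auto
    ultimately show ?thesis using False by simp
  qed
qed

lemma fps_ln_compose_deriv:
  fixes f :: "complex fps"
  assumes "fps_nth f 0 = 0"
  shows "fps_deriv (fps_ln 1 oo f) = inverse (1 + f) * fps_deriv f"
  using assms
  by (simp add: fps_compose_deriv fps_ln_deriv fps_inverse_compose fps_compose_add_distrib)

text \<open>
  The coefficients are compared in \<open>t (log (1 + f))' = t f' / (1 + f)\<close>. The factor \<open>t\<close> keeps the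
  degrees aligned: the coefficient of degree \<open>i\<close> on the left is \<open>i\<close> times that of the logarithm.
\<close>

lemma straight_line_ln:
  assumes superadditive: "\<And>n. n \<ge> 1 \<Longrightarrow> 2 * M n \<le> M (2 * n)"
    and F0: "\<And>p. fps_nth (F p) 0 = 0"
    and F: "coeff_funs n F \<subseteq> S \<union> range (\<lambda>c _. c)"
  shows "straight_line S (9 * M n) (coeff_funs n (\<lambda>p. fps_ln 1 oo F p))"
proof -
  define I where "I p = inverse (1 + F p)" for p
  define D where "D p = fps_X * fps_deriv (F p)" for p
  define Q where "Q p = I p * D p" for p
  have "(\<lambda>p. fps_nth (1 + F p) i) \<in> S \<union> range (\<lambda>c _. c)" if "i \<le> n" for i
    using F F0 that by (cases "i = 0") (auto simp: coeff_funs_subset_iff)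
  then have "straight_line S (if n = 0 then 0 else 6 * M n) (coeff_funs n I)"
    unfolding I_def using F0
    by (intro straight_line_inverse superadditive) (auto simp: coeff_funs_subset_iff)
  then have I: "straight_line S (6 * M n) (coeff_funs n I)"
    by (rule straight_line_mono) auto
  have D: "straight_line (S \<union> coeff_funs n I) (n + 1) (coeff_funs n D)"
    by (rule straight_line_scale[where F = F and w = of_nat]) (use F in \<open>auto simp: D_def\<close>)
  have Q: "straight_line (S \<union> coeff_funs n I \<union> coeff_funs n D) (M n) (coeff_funs n Q)"
    unfolding Q_def by (intro straight_line_mult) auto
  have "fps_nth (fps_ln 1 oo F p) i = 1 / of_nat i * fps_nth (Q p) i" for p i
  proof -
    have "Q p = fps_X * fps_deriv (fps_ln 1 oo F p)"
      using F0 by (simp add: Q_def I_def D_def fps_ln_compose_deriv mult_ac)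
    \<comment> \<open>For \<open>i = 0\<close> both sides vanish, the right one as \<open>1 / 0 = 0\<close>.\<close>
    then show ?thesis by (cases i) (simp_all add: F0 del: of_nat_Suc)
  qed
  then have "straight_line (S \<union> coeff_funs n I \<union> coeff_funs n D \<union> coeff_funs n Q) (n + 1)
      (coeff_funs n (\<lambda>p. fps_ln 1 oo F p))"
    by (intro straight_line_scale[where F = Q and w = "\<lambda>i. 1 / of_nat i"]) auto
  from straight_line_then[OF I straight_line_then[OF D straight_line_then[OF Q this]]]
  show ?thesis by (rule straight_line_mono) (use Suc_le_M[of n] in auto)
qed

text \<open>
  As \<open>f\<close> has no constant term, powers beyond the \<open>i\<close>-th do not reach degree \<open>i\<close>, so that the finite
  sum agrees with the composition of formal power series.
\<close>

lemma V_log1p_nth: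
  assumes "fps_nth f 0 = 0" "i \<le> n"
  shows "fps_nth (V_log1p n f) i = fps_nth (fps_ln 1 oo f) i"
proof -
  have "fps_nth (V_log1p n f) i = (\<Sum>k=1..n. fps_nth (fps_ln 1) k * fps_nth (f ^ k) i)"
    unfolding V_log1p_def fps_sum_nth
  proof (rule sum.cong)
    fix k assume "k \<in> {1..n}"
    moreover from this have "(-1 :: complex) ^ (k + 1) = (-1) ^ (k - 1)" by (cases k) auto
    ultimately show "fps_nth (fps_const ((-1) ^ (k + 1) / of_nat k) * V_power n f k) i
        = fps_nth (fps_ln 1) k * fps_nth (f ^ k) i"
      using assms(2) by (simp add: fps_ln_nth del: power_Suc flip: fps_cutoff_power)
  qed simp
  also have "\<dots> = (\<Sum>k=0..i. fps_nth (fps_ln 1) k * fps_nth (f ^ k) i)"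
  proof -
    have "(\<Sum>k=1..n. fps_nth (fps_ln 1) k * fps_nth (f ^ k) i)
        = (\<Sum>k=0..n. fps_nth (fps_ln 1) k * fps_nth (f ^ k) i)"
      by (intro sum.mono_neutral_left) (auto simp: not_le)
    also have "\<dots> = (\<Sum>k=0..i. fps_nth (fps_ln 1) k * fps_nth (f ^ k) i)"
      using assms startsby_zero_power_prefix[OF assms(1)]
      by (intro sum.mono_neutral_right) auto
    finally show ?thesis .
  qed
  finally show ?thesis by (simp add: fps_compose_nth)
qed

lemma log1p_circuit_exists:
  assumes "\<And>n. n \<ge> 1 \<Longrightarrow> 2 * M n \<le> M (2 * n)"
  shows "\<exists>C. computes C (log1p_problem n) \<and> cost C \<le> 9 * M n"
proof -
  \<comment> \<open>Multiples of \<open>t\<close> parametrize the series without constant term by all series.\<close>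
  define F where "F p = fps_X * p" for p :: "complex fps"
  have "straight_line (set (coeff_list n F)) (9 * M n)
      (set (coeff_list n (\<lambda>p. fps_ln 1 oo F p)))"
    unfolding set_coeff_list 
    by (intro straight_line_ln assms Un_upper1) (simp_all add: F_def)
  then show ?thesis
  proof (rule circuit_of_straight_line)
    fix xs ys assume "(xs, ys) \<in> log1p_problem n"
    then obtain f where f: "xs = coeffs_upto n f" "ys = coeffs_upto n (V_log1p n f)"
      "fps_nth f 0 = 0" unfolding log1p_problem_def by blast
    have "F (fps_shift 1 f) = f"
      using f(3) by (auto simp: F_def fps_eq_iff)
    moreover have "coeffs_upto n (V_log1p n f) = coeffs_upto n (fps_ln 1 oo f)"
      using f(3) by (intro coeffs_upto_cong V_log1p_nth)
    ultimately show "\<exists>p. xs = map (\<lambda>f. f p) (coeff_list n F) \<and>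
        ys = map (\<lambda>g. g p) (coeff_list n (\<lambda>p. fps_ln 1 oo F p))"
      using f by (intro exI[of _ "fps_shift 1 f"]) (simp add: map_coeff_list)
  qed
qed

section \<open>Multiplication from logarithms\<close>

lemma V_log1p_cutoff: "V_log1p n (fps_cutoff (Suc n) f) = V_log1p n f"
proof -
  have "V_power n (fps_cutoff (Suc n) f) k = V_power n f k" for k
  proof (induction k)
    case (Suc k)
    then show ?case
      unfolding V_power.simps by (intro V_mult_cong) (simp_all add: fps_eq_iff)
  qed simp
  then show ?thesis by (simp add: V_log1p_def)
qed

lemma straight_line_log1p:
  assumes "computes C (log1p_problem n)"
    and F0: "\<And>p. fps_nth (F p) 0 = 0"
    and F: "coeff_funs n F \<subseteq> S \<union> range (\<lambda>c _. c)"
  shows "straight_line S (complexity (log1p_problem n)) (coeff_funs n (\<lambda>p. fps_ln 1 oo F p))"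
proof -
  obtain C' where C': "computes C' (log1p_problem n)" "cost C' = complexity (log1p_problem n)"
    using assms(1) by (rule complexity_attained)
  have "(map (\<lambda>f. f p) (coeff_list n F), map (\<lambda>g. g p) (coeff_list n (\<lambda>p. fps_ln 1 oo F p)))
      \<in> log1p_problem n" for p
  proof -
    let ?f = "fps_cutoff (Suc n) (F p)"
    have "coeffs_upto n ?f = coeffs_upto n (F p)"
      by (intro coeffs_upto_cong) simp
    moreover have "coeffs_upto n (V_log1p n ?f) = coeffs_upto n (fps_ln 1 oo F p)"
      unfolding V_log1p_cutoff by (intro coeffs_upto_cong V_log1p_nth F0)
    moreover have "?f \<in> V n" "fps_nth ?f 0 = 0" using F0 by (auto simp: V_def)
    ultimately show ?thesis unfolding log1p_problem_def map_coeff_list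
      by (intro CollectI exI[of _ ?f]) simp
  qed
  from straight_line_of_circuit[OF C'(1) this] show ?thesis
    using F C'(2) by (simp add: set_coeff_list)
qed

lemma fps_ln_compose_X_power_nth:
  assumes "1 \<le> i" "i \<le> k"
  shows "fps_nth (fps_ln (1 :: complex) oo fps_X ^ k) i = (if i = k then 1 else 0)"
proof -
  have "fps_nth (fps_ln 1) j * fps_nth ((fps_X ^ k) ^ j) i
      = (if j = 1 then if i = k then 1 else 0 else 0 :: complex)" for j
  proof -
    have "i \<noteq> k * j" if "j \<noteq> 1"
    proof (cases j)
      case (Suc l)
      with that have "k * 2 \<le> k * j" by (intro mult_le_mono) auto
      with assms show ?thesis by auto
    qed (use assms in simp)
    then show ?thesis by (auto simp: fps_ln_nth fps_X_power_nth simp flip: power_mult)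
  qed
  then show ?thesis using assms by (simp add: fps_compose_nth)
qed

text \<open>
  The coefficients of degrees \<open>2, \<dots>, n\<close> of \<open>log (1 + f)\<close> need a gate each: they are told apart by the
  inputs \<open>f = t\<^sup>k\<close>, whose logarithms begin with \<open>t\<^sup>k\<close>. At \<open>f = t\<close> all of them are nonzero, whereas the
  first coefficient is the only input with this property; but that one vanishes at \<open>f = t\<^sup>i\<close> for
  \<open>i \<ge> 2\<close>. Degree 1 is left out because this coefficient is an input.
\<close>

lemma le_complexity_log1p:
  assumes "computes C (log1p_problem n)"
  shows "n \<le> complexity (log1p_problem n) + 1"
proof -
  define F where "F p = fps_X * p" for p :: "complex fps"
  define h where "h i p = fps_nth (fps_ln 1 oo F p) i" for i p
  have "straight_line (coeff_funs n F) (complexity (log1p_problem n))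
      (coeff_funs n (\<lambda>p. fps_ln 1 oo F p))"
    by (intro straight_line_log1p[OF assms] Un_upper1) (simp add: F_def)
  then have sl: "straight_line (coeff_funs n F) (complexity (log1p_problem n)) (h ` {2..n})"
    by (rule straight_line_mono) (auto simp: h_def[abs_def] coeff_funs_def)
  \<comment> \<open>The parameter \<open>t\<^sup>k\<^sup>-\<^sup>1\<close> stands for the input \<open>t\<^sup>k\<close>.\<close>
  have F_power: "F (fps_X ^ (k - 1)) = fps_X ^ k" if "1 \<le> k" for k
    using that by (cases k) (auto simp: F_def)
  have h_power: "h i (fps_X ^ (k - 1)) = (if i = k then 1 else 0)" if "1 \<le> i" "i \<le> k" for i k
    using that F_power[of k] by (simp add: h_def fps_ln_compose_X_power_nth)
  have "h i \<noteq> (\<lambda>_. c)" if "2 \<le> i" for i c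
  proof -
    have "h i (fps_X ^ (i - 1)) = 1" "h i (fps_X ^ (Suc i - 1)) = 0"
      using that by (simp_all only: h_power) auto
    then show ?thesis by auto
  qed
  moreover have "h i \<noteq> (\<lambda>p. fps_nth (F p) j)" if "2 \<le> i" for i j
  proof
    assume eq: "h i = (\<lambda>p. fps_nth (F p) j)"
    have "fps_ln 1 oo F 1 = fps_ln 1" by (simp add: F_def)
    then have "h i 1 \<noteq> 0" using that by (simp add: h_def fps_ln_nth)
    then have "j = 1" by (auto simp: eq F_def fps_X_def split: if_splits)
    then have "h i (fps_X ^ (i - 1)) = 0"
      using that by (simp only: eq F_power) (simp add: fps_X_power_nth)
    then show False using h_power[of i i] that by simp
  qed
  ultimately have "h ` {2..n} \<inter> (coeff_funs n F \<union> range (\<lambda>c _. c)) = {}"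
    by (auto simp: coeff_funs_def)
  from straight_line_card_le[OF sl this]
  have "card (h ` {2..n}) \<le> complexity (log1p_problem n)" .
  moreover have "inj_on h {2..n}"
  proof (rule linorder_inj_onI)
    fix i j assume "i < j" "i \<in> {2..n}" "j \<in> {2..n}"
    then have "h i (fps_X ^ (j - 1)) = 0" "h j (fps_X ^ (j - 1)) = 1"
      using h_power[of i j] h_power[of j j] by simp_all
    then show "h i \<noteq> h j" by auto
  qed auto
  ultimately show ?thesis by (simp add: card_image)
qed

text \<open>
  In degrees from \<open>4 b\<close> to \<open>6 b - 1\<close> only the quadratic term \<open>- (t\<^sup>2\<^sup>b h)\<^sup>2 / 2\<close> of the logarithm is
  present: the linear term ends below degree \<open>3 b\<close>, and all others begin at \<open>6 b\<close> or later.
\<close>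

lemma fps_ln_compose_square_nth:
  fixes h :: "complex fps"
  assumes "\<And>k. k \<ge> b \<Longrightarrow> fps_nth h k = 0" "j < 2 * b"
  shows "fps_nth (h\<^sup>2) j = - 2 * fps_nth (fps_ln 1 oo (fps_X ^ (2 * b) * h)) (4 * b + j)"
proof -
  have "fps_nth (fps_ln 1) k * fps_nth ((fps_X ^ (2 * b) * h) ^ k) (4 * b + j)
      = (if k = 2 then - fps_nth (h\<^sup>2) j / 2 else 0)" for k
  proof -
    have nth: "fps_nth ((fps_X ^ (2 * b) * h) ^ k) (4 * b + j) =
        (if 4 * b + j < 2 * b * k then 0 else fps_nth (h ^ k) (4 * b + j - 2 * b * k))"
      by (simp add: power_mult_distrib fps_X_power_mult_nth flip: power_mult)
    consider "k = 0" | "k = 1" | "k = 2" | "k \<ge> 3" by linarith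
    then show ?thesis
    proof cases
      case 4
      then have "2 * b * 3 \<le> 2 * b * k" by (intro mult_le_mono) auto
      with assms(2) have "4 * b + j < 2 * b * k" by linarith
      with 4 show ?thesis by (simp add: nth)
    qed (use assms nth in \<open>simp_all add: fps_ln_nth\<close>)
  qed
  moreover have "2 \<le> 4 * b + j" using assms(2) by auto
  ultimately show ?thesis by (simp add: fps_compose_nth)
qed

lemma square_nth_eq_0:
  fixes h :: "complex fps"
  assumes "\<And>k. k \<ge> b \<Longrightarrow> fps_nth h k = 0" "j \<ge> 2 * b"
  shows "fps_nth (h\<^sup>2) j = 0"
  unfolding power2_eq_square fps_mult_nth
proof (rule sum.neutral, rule ballI)
  fix i assume "i \<in> {0..j}"
  then have "i \<ge> b \<or> j - i \<ge> b" using assms(2) by auto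
  then show "fps_nth h i * fps_nth h (j - i) = 0" using assms(1) by auto
qed

lemma coeff_funs_shift_subset:
  assumes "coeff_funs n F \<subseteq> T \<union> range (\<lambda>c _. c)"
  shows "coeff_funs n (\<lambda>p. fps_X ^ k * F p) \<subseteq> T \<union> range (\<lambda>c _. c)"
proof -
  have "(\<lambda>p. fps_nth (fps_X ^ k * F p) i) \<in> T \<union> range (\<lambda>c _. c)" if "i \<le> n" for i
    using assms that
    by (cases "i < k") (auto simp: fps_X_power_mult_nth coeff_funs_subset_iff)
  then show ?thesis by (simp add: coeff_funs_subset_iff)
qed

lemma straight_line_square:
  assumes C: "computes C (log1p_problem n)" and b: "1 \<le> b" "6 * b \<le> n + 1"
    and H0: "\<And>p k. k \<ge> b \<Longrightarrow> fps_nth (H p) k = 0"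
    and H: "coeff_funs n H \<subseteq> S \<union> range (\<lambda>c _. c)"
  shows "straight_line S (complexity (log1p_problem n) + (n + 1)) (coeff_funs n (\<lambda>p. (H p)\<^sup>2))"
proof -
  define L where "L p = fps_ln 1 oo (fps_X ^ (2 * b) * H p)" for p
  have "straight_line S (complexity (log1p_problem n)) (coeff_funs n L)"
    unfolding L_def using C
    by (rule straight_line_log1p)
      (use b in \<open>simp add: fps_X_power_mult_nth\<close>, rule coeff_funs_shift_subset[OF H])
  moreover have "straight_line (S \<union> coeff_funs n L) (n + 1) (coeff_funs n (\<lambda>p. (H p)\<^sup>2))"
  proof (rule straight_line_coeffwise)
    fix j assume "j \<le> n"
    show "straight_line (S \<union> coeff_funs n L) 1 {\<lambda>p. fps_nth ((H p)\<^sup>2) j}"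
    proof (cases "j < 2 * b")
      case True
      have sq: "fps_nth ((H p)\<^sup>2) j = - 2 * fps_nth (L p) (4 * b + j)" for p
        unfolding L_def by (rule fps_ln_compose_square_nth[OF H0 True])
      have "(\<lambda>p. fps_nth (L p) (4 * b + j)) \<in> coeff_funs n L"
        using True b(2) by (auto simp: coeff_funs_def)
      then show ?thesis
        by (intro straight_line_op[where q = Mul and a = "\<lambda>_. - 2"]) (auto simp: sq)
    next
      case False
      then have "fps_nth ((H p)\<^sup>2) j = 0" for p by (intro square_nth_eq_0[OF H0]) auto
      then show ?thesis by (intro straight_line_trivial) auto
    qed
  qed
  ultimately show ?thesis by (rule straight_line_then)
qed

text \<open>
  Polarization: \<open>4 F G = (F + G)\<^sup>2 - (F - G)\<^sup>2\<close>.
\<close>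

lemma straight_line_block_mult:
  assumes C: "computes C (log1p_problem n)" and b: "1 \<le> b" "6 * b \<le> n + 1"
    and F0: "\<And>p k. k \<ge> b \<Longrightarrow> fps_nth (F p) k = 0" and G0: "\<And>p k. k \<ge> b \<Longrightarrow> fps_nth (G p) k = 0"
    and F: "coeff_funs n F \<subseteq> S \<union> range (\<lambda>c _. c)" and G: "coeff_funs n G \<subseteq> S \<union> range (\<lambda>c _. c)"
  shows "straight_line S (2 * complexity (log1p_problem n) + 6 * (n + 1))
    (coeff_funs n (\<lambda>p. F p * G p))"
proof -
  let ?l = "complexity (log1p_problem n)"
  define A where "A p = F p + G p" for p
  define B where "B p = F p - G p" for p
  define D where "D p = (A p)\<^sup>2 - (B p)\<^sup>2" for p
  let ?T = "coeff_funs n A \<union> coeff_funs n B"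
  let ?U = "coeff_funs n (\<lambda>p. (A p)\<^sup>2) \<union> coeff_funs n (\<lambda>p. (B p)\<^sup>2)"
  have T: "straight_line S ((n + 1) + (n + 1)) ?T"
    unfolding A_def B_def by (intro straight_line_Un straight_line_add straight_line_diff F G)
  have U: "straight_line (S \<union> ?T) ((?l + (n + 1)) + (?l + (n + 1))) ?U"
  proof (intro straight_line_Un straight_line_square[OF C b])
    show "fps_nth (A p) k = 0" "fps_nth (B p) k = 0" if "k \<ge> b" for p k
      using that by (simp_all add: A_def B_def F0 G0)
  qed auto
  have D: "straight_line (S \<union> ?T \<union> ?U) (n + 1) (coeff_funs n D)"
    unfolding D_def by (intro straight_line_diff) auto
  have "F p * G p = fps_const (1 / 4) * D p" for p
  proof -
    have "D p = fps_const 4 * (F p * G p)"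
      by (simp add: D_def A_def B_def power2_eq_square algebra_simps flip: numeral_fps_const)
    then show ?thesis by (simp flip: mult.assoc)
  qed
  then have "straight_line (S \<union> ?T \<union> ?U \<union> coeff_funs n D) (n + 1)
      (coeff_funs n (\<lambda>p. F p * G p))"
    by (intro straight_line_scale[where F = D and w = "\<lambda>_. 1 / 4"]) auto
  from straight_line_then[OF T straight_line_then[OF U straight_line_then[OF D this]]]
  show ?thesis by (rule straight_line_mono) auto
qed

lemma fps_cutoff_blocks:
  "fps_cutoff (r * b) f = (\<Sum>i<r. fps_X ^ (i * b) * fps_cutoff b (fps_shift (i * b) f))"
proof (induction r)
  case 0
  show ?case by simp
next
  case (Suc r)
  have "fps_cutoff (Suc r * b) f
      = fps_cutoff (r * b) f + fps_X ^ (r * b) * fps_cutoff b (fps_shift (r * b) f)"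
    by (auto simp: fps_eq_iff fps_X_power_mult_nth)
  then show ?case using Suc.IH by simp
qed

text \<open>
  Blocks have length \<open>b = (n + 1) div 6\<close>, so that a logarithm in \<open>V\<^sub>n\<close> reaches all degrees below
  \<open>6 b\<close>, where the squares of blocks are found. Because of the rounding, six blocks need not cover the degrees up to \<open>n\<close>; twelve do, as
  soon as \<open>b \<ge> 1\<close>. This gives \<open>144\<close> block products, each of which is added up in \<open>n + 1\<close> operations.
\<close>

lemma M_le_complexity_log1p:
  assumes C: "computes C (log1p_problem n)" and n: "n \<ge> 5"
  shows "M n \<le> 144 * (2 * complexity (log1p_problem n) + 7 * (n + 1))"
proof (rule M_le_of_straight_line)
  define b where "b = (n + 1) div 6"
  have b: "1 \<le> b" "6 * b \<le> n + 1" "Suc n \<le> 12 * b" using n unfolding b_def by presburger+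
  let ?S = "coeff_funs n fst \<union> coeff_funs n snd :: (complex fps \<times> complex fps \<Rightarrow> complex) set"
  let ?l = "complexity (log1p_problem n)"
  define block where "block i f = fps_cutoff b (fps_shift (i * b) (fps_cutoff (Suc n) f))"
    for i and f :: "complex fps"
  define Q where "Q = (\<lambda>(i, j) p. fps_X ^ (i * b + j * b) * (block i (fst p) * block j (snd p)))"
  have block_0: "fps_nth (block i f) k = 0" if "k \<ge> b" for i f k
    using that by (simp add: block_def)
  have block_subset: "coeff_funs n (\<lambda>p. block i (F p)) \<subseteq> coeff_funs n F \<union> range (\<lambda>c _. c)"
    for i and F :: "complex fps \<times> complex fps \<Rightarrow> complex fps"
  proof -
    have nth: "fps_nth (block i f) k = (if k < b \<and> k + i * b \<le> n then fps_nth f (k + i * b) else 0)"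
      for f k by (simp add: block_def)
    have "(\<lambda>p. fps_nth (block i (F p)) k) \<in> coeff_funs n F \<union> range (\<lambda>c _. c)" for k
      by (cases "k < b \<and> k + i * b \<le> n") (auto simp: nth coeff_funs_def)
    then show ?thesis by (simp add: coeff_funs_subset_iff)
  qed
  have "straight_line ?S (2 * ?l + 6 * (n + 1)) (coeff_funs n (Q ij))" for ij
  proof -
    obtain i j where ij: "ij = (i, j)" by (cases ij)
    have *: "straight_line ?S (2 * ?l + 6 * (n + 1))
        (coeff_funs n (\<lambda>p. block i (fst p) * block j (snd p)))"
      using block_subset[of i fst] block_subset[of j snd]
      by (intro straight_line_block_mult[OF C b(1,2)] block_0) auto
    have "straight_line ?S (2 * ?l + 6 * (n + 1) + 0) (coeff_funs n (Q ij))"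
      unfolding ij Q_def prod.case
      by (rule straight_line_then[OF *], rule straight_line_trivial, rule coeff_funs_shift_subset)
        auto
    then show ?thesis by simp
  qed
  then have "straight_line ?S (card ({..<12::nat} \<times> {..<12::nat}) * ((2 * ?l + 6 * (n + 1)) + (n + 1)))
      (coeff_funs n (\<lambda>p. \<Sum>ij\<in>{..<12} \<times> {..<12}. Q ij p))"
    by (intro straight_line_sum) auto
  moreover have "(\<Sum>ij\<in>{..<12} \<times> {..<12}. Q ij p)
      = fps_cutoff (Suc n) (fst p) * fps_cutoff (Suc n) (snd p)" for p
  proof -
    have blocks: "fps_cutoff (Suc n) f = (\<Sum>i<12. fps_X ^ (i * b) * block i f)" for f
    proof -
      have "fps_cutoff (Suc n) f = fps_cutoff (12 * b) (fps_cutoff (Suc n) f)"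
        using b(3) by (auto simp: fps_eq_iff)
      then show ?thesis unfolding block_def by (simp only: fps_cutoff_blocks[of 12])
    qed
    show ?thesis
      unfolding blocks sum_product sum.cartesian_product
      by (intro sum.cong) (auto simp: Q_def power_add mult_ac)
  qed
  ultimately show "straight_line ?S (144 * (2 * ?l + 7 * (n + 1)))
      (coeff_funs n (\<lambda>p. fps_cutoff (Suc n) (fst p) * fps_cutoff (Suc n) (snd p)))"
    by (auto elim!: straight_line_mono)
qed

theorem theorem2:
  assumes superadditive: "\<And>n. n \<ge> 1 \<Longrightarrow> M (2 * n) \<ge> 2 * M n"
  shows "(\<lambda>n. real (complexity (log1p_problem n))) \<in> \<Theta>(\<lambda>n. real (M n))"
proof (rule bigthetaI)
  have upper: "complexity (log1p_problem n) \<le> 9 * M n" for n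
    using log1p_circuit_exists[OF superadditive] complexity_le order_trans by blast
  then have "real (complexity (log1p_problem n)) \<le> 9 * real (M n)" for n
    by (metis of_nat_le_iff of_nat_mult of_nat_numeral)
  then show "(\<lambda>n. real (complexity (log1p_problem n))) \<in> O(\<lambda>n. real (M n))"
    by (intro bigoI[where c = 9]) auto
  \<comment> \<open>For \<open>n \<ge> 5\<close> the complexity \<open>l\<close> of the logarithm is at least \<open>n - 1 \<ge> 4\<close>, so \<open>n + 1 \<le> l + 2 \<le> 2 * l\<close>,
    and \<open>144 * (2 * l + 7 * (2 * l)) = 2304 * l\<close>.\<close>
  have lower: "M n \<le> 2304 * complexity (log1p_problem n)" if "n \<ge> 5" for n
  proof -
    obtain C where C: "computes C (log1p_problem n)"
      using log1p_circuit_exists[OF superadditive] by blast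
    show ?thesis
      using M_le_complexity_log1p[OF C that] le_complexity_log1p[OF C] that
      unfolding distrib_left by linarith
  qed
  then have "real (M n) \<le> 2304 * real (complexity (log1p_problem n))" if "n \<ge> 5" for n
    using that by (metis of_nat_le_iff of_nat_mult of_nat_numeral)
  then have "(\<lambda>n. real (M n)) \<in> O(\<lambda>n. real (complexity (log1p_problem n)))"
    by (intro bigoI[where c = 2304]) (auto simp: eventually_at_top_linorder)
  then show "(\<lambda>n. real (complexity (log1p_problem n))) \<in> \<Omega>(\<lambda>n. real (M n))"
    by (simp add: bigomega_iff_bigo)
qed

end
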